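(* $\mathsf{Syn}^-$ is sound and complete with respect to $\delta$-models: for every formula $\varphi$, $\varphi$ is derivable in $\mathsf{Syn}^-$ if and only if $\varphi$ is true at every world of every $\delta$-model.
   Context: Fix a finite set $\mathsf{Ag}$ of agents; an agent pattern is a set $G\subseteq\mathcal{P}(\mathsf{Ag})\setminus\{\emptyset\}$. Formulas: $\varphi::= p\mid\neg\varphi\mid\varphi\wedge\varphi\mid [G]\varphi$ ($p$ in a countable set $\mathsf{Prop}$, $G$ an agent pattern); $\bot:=p\wedge\neg p$ for fixed $p$; $\mathsf{alive}(G):=\neg[G]\bot$. $\mathsf{Syn}^-$ has axioms: all propositional tautologies; (K) $[G](\varphi\to\psi)\to([G]\varphi\to[G]\psi)$; (B) $\varphi\to[G]\neg[G]\neg\varphi$; (4) $[G]\varphi\to[G][G]\varphi$; (T) $\mathsf{alive}(G)\to([G]\varphi\to\varphi)$; (NE) $\bigvee_{G}\mathsf{alive}(G)$ over all agent patterns; (Mono) $[G]\varphi\to[H]\varphi$ if $G\subseteq H$; (Equiv) $[G\cup\{B\}]\varphi\to[G]\varphi$ if some $A\in G$ has $B\subseteq A$ ($B\ne\emptyset$); (Union) $\mathsf{alive}(G)\wedge\mathsf{alive}(H)\to\mathsf{alive}(G\cup H)$; (Clo) $\mathsf{alive}(G)\to\mathsf{alive}(\{A\cup B\})$ for $A,B\in G$; rules modus ponens and $[G]$-necessitation. A pre-model $\mathcal{M}=(W,\sim,V)$ consists of a set $W$, a function assigning to each agent pattern $G$ a symmetric and transitive relation $\sim_G$ on $W$, and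 $V:W\to\mathcal{P}(\mathsf{Prop})$. Truth: $\mathcal{M},w\Vdash p$ iff $p\in V(w)$; Boolean clauses as usual; $\mathcal{M},w\Vdash[G]\varphi$ iff $\mathcal{M},v\Vdash\varphi$ for all $v$ with $w\sim_G v$. $\mathsf{alive}(G)_\mathcal{M}=\{w\mid w\sim_G w\}$. A $\delta$-model is a pre-model such that for all agent patterns $G,H$: (K2) $\mathsf{alive}(G)_\mathcal{M}\subseteq\mathsf{alive}(\{A\cup B\})_\mathcal{M}$ for $A,B\in G$; (K3) $\sim_H\subseteq\sim_G$ if $G\subseteq H$; (K4) $\sim_G\subseteq\sim_{G\cup\{B\}}$ if some $A\in G$ has $\emptyset\ne B\subseteq A$; (NE) every $w$ has some $G$ with $w\sim_G w$; (D) $\sim_G=\bigcap_{B\in G}\sim_{\{B\}}$. *)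

theory Defs
  imports "HOL-Library.Countable"
begin

definition agent_patterns :: "'a set \<Rightarrow> 'a set set set" where
  "agent_patterns Ag = Pow (Pow Ag - {{}})"

datatype ('a, 'p) fm =
    Atom 'p
  | Neg "('a, 'p) fm"
  | Conj "('a, 'p) fm" "('a, 'p) fm"
  | Box "'a set set" "('a, 'p) fm"

text \<open>The datatype admits arbitrary sets of sets under a box; the formulas of the language over
  \<open>Ag\<close> are those in which only agent patterns occur.\<close>

primrec is_formula :: "'a set \<Rightarrow> ('a, 'p) fm \<Rightarrow> bool" where
  "is_formula Ag (Atom p) \<longleftrightarrow> True"
| "is_formula Ag (Neg \<phi>) \<longleftrightarrow> is_formula Ag \<phi>"
| "is_formula Ag (Conj \<phi> \<psi>) \<longleftrightarrow> is_formula Ag \<phi> \<and> is_formula Ag \<psi>"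
| "is_formula Ag (Box G \<phi>) \<longleftrightarrow> G \<in> agent_patterns Ag \<and> is_formula Ag \<phi>"

definition Disj :: "('a, 'p) fm \<Rightarrow> ('a, 'p) fm \<Rightarrow> ('a, 'p) fm" where
  "Disj \<phi> \<psi> = Neg (Conj (Neg \<phi>) (Neg \<psi>))"

definition Imp :: "('a, 'p) fm \<Rightarrow> ('a, 'p) fm \<Rightarrow> ('a, 'p) fm" where
  "Imp \<phi> \<psi> = Neg (Conj \<phi> (Neg \<psi>))"

text \<open>The parameter \<open>p0\<close> is the fixed atom used to express falsity.\<close>

definition Bot :: "'p \<Rightarrow> ('a, 'p) fm" where
  "Bot p0 = Conj (Atom p0) (Neg (Atom p0))"

definition alive :: "'p \<Rightarrow> 'a set set \<Rightarrow> ('a, 'p) fm" where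
  "alive p0 G = Neg (Box G (Bot p0))"

fun Disj_list :: "'p \<Rightarrow> ('a, 'p) fm list \<Rightarrow> ('a, 'p) fm" where
  "Disj_list p0 [] = Bot p0"
| "Disj_list p0 [\<phi>] = \<phi>"
| "Disj_list p0 (\<phi> # \<psi> # \<chi>s) = Disj \<phi> (Disj_list p0 (\<psi> # \<chi>s))"

text \<open>Propositional tautologies are instances in the modal language: boxed formulas are evaluated
  like atoms, by an arbitrary truth assignment.\<close>

primrec prop_eval :: "(('a, 'p) fm \<Rightarrow> bool) \<Rightarrow> ('a, 'p) fm \<Rightarrow> bool" where
  "prop_eval v (Atom p) \<longleftrightarrow> v (Atom p)"
| "prop_eval v (Neg \<phi>) \<longleftrightarrow> \<not> prop_eval v \<phi>"
| "prop_eval v (Conj \<phi> \<psi>) \<longleftrightarrow> prop_eval v \<phi> \<and> prop_eval v \<psi>"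
| "prop_eval v (Box G \<phi>) \<longleftrightarrow> v (Box G \<phi>)"

definition tautology :: "('a, 'p) fm \<Rightarrow> bool" where
  "tautology \<phi> \<longleftrightarrow> (\<forall>v. prop_eval v \<phi>)"

text \<open>In \<open>NE\<close> the disjunction over the finite set of all agent patterns is taken along an arbitrary
  enumeration without repetition.\<close>

inductive Syn_minus :: "'a set \<Rightarrow> 'p \<Rightarrow> ('a, 'p) fm \<Rightarrow> bool" for Ag :: "'a set" and p0 :: 'p where
  Taut: "is_formula Ag \<phi> \<Longrightarrow> tautology \<phi> \<Longrightarrow> Syn_minus Ag p0 \<phi>"
| K: "G \<in> agent_patterns Ag \<Longrightarrow> is_formula Ag \<phi> \<Longrightarrow> is_formula Ag \<psi> \<Longrightarrow>
    Syn_minus Ag p0 (Imp (Box G (Imp \<phi> \<psi>)) (Imp (Box G \<phi>) (Box G \<psi>)))"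
| B: "G \<in> agent_patterns Ag \<Longrightarrow> is_formula Ag \<phi> \<Longrightarrow>
    Syn_minus Ag p0 (Imp \<phi> (Box G (Neg (Box G (Neg \<phi>)))))"
| Four: "G \<in> agent_patterns Ag \<Longrightarrow> is_formula Ag \<phi> \<Longrightarrow>
    Syn_minus Ag p0 (Imp (Box G \<phi>) (Box G (Box G \<phi>)))"
| T: "G \<in> agent_patterns Ag \<Longrightarrow> is_formula Ag \<phi> \<Longrightarrow>
    Syn_minus Ag p0 (Imp (alive p0 G) (Imp (Box G \<phi>) \<phi>))"
| NE: "distinct Gs \<Longrightarrow> set Gs = agent_patterns Ag \<Longrightarrow>
    Syn_minus Ag p0 (Disj_list p0 (map (alive p0) Gs))"
| Mono: "G \<in> agent_patterns Ag \<Longrightarrow> H \<in> agent_patterns Ag \<Longrightarrow> G \<subseteq> H \<Longrightarrow> is_formula Ag \<phi> \<Longrightarrow>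
    Syn_minus Ag p0 (Imp (Box G \<phi>) (Box H \<phi>))"
| Equiv: "G \<in> agent_patterns Ag \<Longrightarrow> A \<in> G \<Longrightarrow> B \<subseteq> A \<Longrightarrow> B \<noteq> {} \<Longrightarrow> is_formula Ag \<phi> \<Longrightarrow>
    Syn_minus Ag p0 (Imp (Box (G \<union> {B}) \<phi>) (Box G \<phi>))"
| Union: "G \<in> agent_patterns Ag \<Longrightarrow> H \<in> agent_patterns Ag \<Longrightarrow>
    Syn_minus Ag p0 (Imp (Conj (alive p0 G) (alive p0 H)) (alive p0 (G \<union> H)))"
| Clo: "G \<in> agent_patterns Ag \<Longrightarrow> A \<in> G \<Longrightarrow> B \<in> G \<Longrightarrow>
    Syn_minus Ag p0 (Imp (alive p0 G) (alive p0 {A \<union> B}))"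
| MP: "Syn_minus Ag p0 \<phi> \<Longrightarrow> Syn_minus Ag p0 (Imp \<phi> \<psi>) \<Longrightarrow> Syn_minus Ag p0 \<psi>"
| Nec: "G \<in> agent_patterns Ag \<Longrightarrow> Syn_minus Ag p0 \<phi> \<Longrightarrow> Syn_minus Ag p0 (Box G \<phi>)"

record ('w, 'a, 'p) model =
  worlds :: "'w set"
  rel :: "'a set set \<Rightarrow> ('w \<times> 'w) set"
  val :: "'w \<Rightarrow> 'p set"

definition pre_model :: "'a set \<Rightarrow> ('w, 'a, 'p) model \<Rightarrow> bool" where
  "pre_model Ag M \<longleftrightarrow>
    (\<forall>G \<in> agent_patterns Ag. rel M G \<subseteq> worlds M \<times> worlds M \<and> sym (rel M G) \<and> trans (rel M G))"

primrec sat :: "('w, 'a, 'p) model \<Rightarrow> 'w \<Rightarrow> ('a, 'p) fm \<Rightarrow> bool" where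
  "sat M w (Atom p) \<longleftrightarrow> p \<in> val M w"
| "sat M w (Neg \<phi>) \<longleftrightarrow> \<not> sat M w \<phi>"
| "sat M w (Conj \<phi> \<psi>) \<longleftrightarrow> sat M w \<phi> \<and> sat M w \<psi>"
| "sat M w (Box G \<phi>) \<longleftrightarrow> (\<forall>v. (w, v) \<in> rel M G \<longrightarrow> sat M v \<phi>)"

definition alive_set :: "('w, 'a, 'p) model \<Rightarrow> 'a set set \<Rightarrow> 'w set" where
  "alive_set M G = {w \<in> worlds M. (w, w) \<in> rel M G}"

text \<open>In the last condition the intersection is taken among relations on the set of worlds, so
  that for the empty agent pattern it is the total relation on the worlds.\<close>

definition delta_model :: "'a set \<Rightarrow> ('w, 'a, 'p) model \<Rightarrow> bool" where
  "delta_model Ag M \<longleftrightarrow>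
    pre_model Ag M \<and>
    (\<forall>G \<in> agent_patterns Ag. \<forall>A \<in> G. \<forall>B \<in> G. alive_set M G \<subseteq> alive_set M {A \<union> B}) \<and>
    (\<forall>G \<in> agent_patterns Ag. \<forall>H \<in> agent_patterns Ag. G \<subseteq> H \<longrightarrow> rel M H \<subseteq> rel M G) \<and>
    (\<forall>G \<in> agent_patterns Ag. \<forall>A \<in> G. \<forall>B. B \<noteq> {} \<and> B \<subseteq> A \<longrightarrow> rel M G \<subseteq> rel M (G \<union> {B})) \<and>
    (\<forall>w \<in> worlds M. \<exists>G \<in> agent_patterns Ag. (w, w) \<in> rel M G) \<and>
    (\<forall>G \<in> agent_patterns Ag. rel M G = (worlds M \<times> worlds M) \<inter> (\<Inter>B \<in> G. rel M {B}))"

end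

theory Submission
  imports Defs "HOL-Library.Countable_Set"
begin

text \<open>
  Completeness. Maximal consistent theories with their canonical relations satisfy every
  condition on \<open>\<delta>\<close>-models except (D): two theories may be related by every \<open>{B}\<close> with \<open>B \<in> G\<close>
  without being related by \<open>G\<close>. Therefore the canonical model is unravelled into a tree, in which
  each edge carries the pattern \<open>H\<close> of the refuted box \<open>[H]\<psi>\<close> that created it. An edge with
  label \<open>H\<close> counts for \<open>B\<close> if \<open>B\<close> is contained in some member of \<open>H\<close>, and two nodes are
  \<open>{B}\<close>-related if both are alive for \<open>{B}\<close> and climbing towards the root along edges that count
  for \<open>B\<close> leads to the same node. The relation of \<open>G\<close> is defined by (D). If two nodes are related
  for every \<open>B \<in> G\<close>, then, paths in a tree being unique, all edges between them count for all of
  \<open>G\<close> at once, so the theories are \<open>G\<close>-related: on each edge by (Equiv) and (Mono), and for the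
  trivial path by (Union). Closure under unions (Clo) only concerns aliveness, which the tree
  inherits from the theories. Only the finitely many boxes in the formula need witnesses, so the
  tree is countable and any infinite type can serve as its set of worlds.
\<close>

section \<open>Formulas\<close>

lemma is_formula_simps [simp]:
  "is_formula Ag (Imp \<phi> \<psi>) \<longleftrightarrow> is_formula Ag \<phi> \<and> is_formula Ag \<psi>"
  "is_formula Ag (Disj \<phi> \<psi>) \<longleftrightarrow> is_formula Ag \<phi> \<and> is_formula Ag \<psi>"
  "is_formula Ag (Bot p0)"
  "is_formula Ag (alive p0 G) \<longleftrightarrow> G \<in> agent_patterns Ag"
  by (auto simp: Imp_def Disj_def Bot_def alive_def)

lemma is_formula_Disj_list [simp]:
  "is_formula Ag (Disj_list p0 \<phi>s) \<longleftrightarrow> (\<forall>\<phi> \<in> set \<phi>s. is_formula Ag \<phi>)"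
  by (induction p0 \<phi>s rule: Disj_list.induct) auto

lemma prop_eval_simps [simp]:
  "prop_eval v (Imp \<phi> \<psi>) \<longleftrightarrow> (prop_eval v \<phi> \<longrightarrow> prop_eval v \<psi>)"
  "prop_eval v (Disj \<phi> \<psi>) \<longleftrightarrow> prop_eval v \<phi> \<or> prop_eval v \<psi>"
  "\<not> prop_eval v (Bot p0)"
  by (auto simp: Imp_def Disj_def Bot_def)

lemma sat_simps [simp]:
  "sat M w (Imp \<phi> \<psi>) \<longleftrightarrow> (sat M w \<phi> \<longrightarrow> sat M w \<psi>)"
  "sat M w (Disj \<phi> \<psi>) \<longleftrightarrow> sat M w \<phi> \<or> sat M w \<psi>"
  "\<not> sat M w (Bot p0)"
  by (auto simp: Imp_def Disj_def Bot_def)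

lemma sat_Disj_list [simp]: "sat M w (Disj_list p0 \<phi>s) \<longleftrightarrow> (\<exists>\<phi> \<in> set \<phi>s. sat M w \<phi>)"
  by (induction p0 \<phi>s rule: Disj_list.induct) auto

text \<open>Makes truth at a world one of the assignments that \<open>tautology\<close> quantifies
  over, which gives soundness of \<open>Taut\<close>.\<close>

lemma prop_eval_sat [simp]: "prop_eval (sat M w) \<phi> \<longleftrightarrow> sat M w \<phi>"
  by (induction \<phi>) auto

lemma finite_agent_patterns: "finite Ag \<Longrightarrow> finite (agent_patterns Ag)"
  by (simp add: agent_patterns_def)

lemma finite_agent_pattern: "finite Ag \<Longrightarrow> G \<in> agent_patterns Ag \<Longrightarrow> finite G"
  unfolding agent_patterns_def by (meson Diff_subset PowD finite_Pow_iff finite_subset)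

lemma agent_patterns_empty [simp]: "{} \<in> agent_patterns Ag"
  by (simp add: agent_patterns_def)

lemma agent_patterns_insert [simp]:
  "insert B G \<in> agent_patterns Ag \<longleftrightarrow> B \<subseteq> Ag \<and> B \<noteq> {} \<and> G \<in> agent_patterns Ag"
  by (auto simp: agent_patterns_def)

lemma agent_patterns_Un [simp]:
  "G \<union> H \<in> agent_patterns Ag \<longleftrightarrow> G \<in> agent_patterns Ag \<and> H \<in> agent_patterns Ag"
  by (auto simp: agent_patterns_def)

lemma agent_patternsD:
  assumes "G \<in> agent_patterns Ag" "B \<in> G"
  shows "B \<subseteq> Ag" "B \<noteq> {}"
  using assms by (auto simp: agent_patterns_def)

lemma Syn_minus_is_formula: "Syn_minus Ag p0 \<phi> \<Longrightarrow> is_formula Ag \<phi>"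
proof (induction rule: Syn_minus.induct)
  case (Equiv G A B \<phi>)
  then show ?case using agent_patternsD(1)[of G Ag A] by auto
next
  case (Clo G A B)
  then show ?case using agent_patternsD[of G Ag A] agent_patternsD[of G Ag B] by auto
qed auto

section \<open>Soundness\<close>

text \<open>\<open>alive\<close> asserts only that some successor exists; going there and back by
  symmetry and transitivity gives the loop at \<open>w\<close>.\<close>

lemma sat_alive:
  assumes "pre_model Ag M" "G \<in> agent_patterns Ag"
  shows "sat M w (alive p0 G) \<longleftrightarrow> (w, w) \<in> rel M G"
proof -
  have "sym (rel M G)" "trans (rel M G)"
    using assms by (auto simp: pre_model_def)
  then show ?thesis
    by (simp add: alive_def) (meson symD transD)
qed

lemma Syn_minus_sound:
  assumes M: "delta_model Ag M"
  shows "Syn_minus Ag p0 \<phi> \<Longrightarrow> w \<in> worlds M \<Longrightarrow> sat M w \<phi>"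
proof (induction arbitrary: w rule: Syn_minus.induct)
  note pre = M[unfolded delta_model_def, THEN conjunct1]
  have sub: "rel M G \<subseteq> worlds M \<times> worlds M" if "G \<in> agent_patterns Ag" for G
    using pre that by (auto simp: pre_model_def)
  have sym: "(v, u) \<in> rel M G" if "G \<in> agent_patterns Ag" "(u, v) \<in> rel M G" for G u v
    using pre that unfolding pre_model_def by (meson symD)
  have trans: "(u, x) \<in> rel M G"
    if "G \<in> agent_patterns Ag" "(u, v) \<in> rel M G" "(v, x) \<in> rel M G" for G u v x
    using pre that unfolding pre_model_def by (meson transD)
  note al = sat_alive[OF pre]
  {
    case (Taut \<phi>)
    then show ?case by (metis prop_eval_sat tautology_def)
  next
    case (K G \<phi> \<psi>)
    then show ?case by auto
  next
    case (B G \<phi>)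
    then show ?case by simp (meson sym)
  next
    case (Four G \<phi>)
    then show ?case by simp (meson trans)
  next
    case (T G \<phi>)
    then show ?case by (auto simp: al)
  next
    case (NE Gs)
    then have "\<exists>G \<in> agent_patterns Ag. (w, w) \<in> rel M G"
      using M by (auto simp: delta_model_def)
    then show ?case using NE by (auto simp: al)
  next
    case (Mono G H \<phi>)
    then have "rel M H \<subseteq> rel M G" using M by (auto simp: delta_model_def)
    then show ?case by auto
  next
    case (Equiv G A B \<phi>)
    then have "rel M G \<subseteq> rel M (G \<union> {B})" using M unfolding delta_model_def by blast
    then show ?case by auto
  next
    case (Union G H)
    have D: "rel M G = (worlds M \<times> worlds M) \<inter> (\<Inter>B \<in> G. rel M {B})"
      if "G \<in> agent_patterns Ag" for G
      using M that unfolding delta_model_def by blast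
    \<comment> \<open>By (D), a union of patterns becomes an intersection of relations, so a loop
      for each of \<open>G\<close> and \<open>H\<close> is a loop for both together.\<close>
    have "rel M (G \<union> H) = rel M G \<inter> rel M H"
      using D[of G] D[of H] D[of "G \<union> H"] Union by auto
    then show ?case using Union by (auto simp: al)
  next
    case (Clo G A B)
    then have "alive_set M G \<subseteq> alive_set M {A \<union> B}"
      using M by (simp add: delta_model_def)
    moreover have "{A \<union> B} \<in> agent_patterns Ag"
      using Clo agent_patternsD[of G Ag A] agent_patternsD[of G Ag B] by auto
    ultimately show ?case using Clo by (auto simp: al alive_set_def)
  next
    case (MP \<phi> \<psi>)
    then show ?case by auto
  next
    case (Nec G \<phi>)
    then show ?case using sub by auto
  }
qed

section \<open>Theories\<close>

text \<open>The closure is under modus ponens and not under necessitation, as truth at one world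
  does not carry over to its successors. Consistency is expressed as omission of some
  formula.\<close>

definition closed_theory :: "'a set \<Rightarrow> 'p \<Rightarrow> ('a, 'p) fm set \<Rightarrow> bool" where
  "closed_theory Ag p0 T \<longleftrightarrow>
    T \<subseteq> {\<phi>. is_formula Ag \<phi>} \<and> {\<phi>. Syn_minus Ag p0 \<phi>} \<subseteq> T \<and>
    (\<forall>\<phi> \<psi>. \<phi> \<in> T \<longrightarrow> Imp \<phi> \<psi> \<in> T \<longrightarrow> \<psi> \<in> T)"

definition mcs :: "'a set \<Rightarrow> 'p \<Rightarrow> ('a, 'p) fm set \<Rightarrow> bool" where
  "mcs Ag p0 T \<longleftrightarrow> closed_theory Ag p0 T \<and> (\<forall>\<phi>. is_formula Ag \<phi> \<longrightarrow> (Neg \<phi> \<in> T \<longleftrightarrow> \<phi> \<notin> T))"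

lemma closed_theoryI:
  assumes "\<And>\<phi>. \<phi> \<in> T \<Longrightarrow> is_formula Ag \<phi>" "\<And>\<phi>. Syn_minus Ag p0 \<phi> \<Longrightarrow> \<phi> \<in> T"
    and "\<And>\<phi> \<psi>. \<phi> \<in> T \<Longrightarrow> Imp \<phi> \<psi> \<in> T \<Longrightarrow> \<psi> \<in> T"
  shows "closed_theory Ag p0 T"
  unfolding closed_theory_def using assms by blast

lemma closed_theory_Syn_minus: "closed_theory Ag p0 {\<phi>. Syn_minus Ag p0 \<phi>}"
  by (auto simp: closed_theory_def Syn_minus_is_formula intro: MP)

lemma closed_theory_taut:
  "closed_theory Ag p0 T \<Longrightarrow> is_formula Ag \<phi> \<Longrightarrow> tautology \<phi> \<Longrightarrow> \<phi> \<in> T"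
  by (auto simp: closed_theory_def intro: Taut)

lemma closed_theory_MP: "closed_theory Ag p0 T \<Longrightarrow> \<phi> \<in> T \<Longrightarrow> Imp \<phi> \<psi> \<in> T \<Longrightarrow> \<psi> \<in> T"
  unfolding closed_theory_def by metis

lemma closed_theory_Syn_MP:
  "closed_theory Ag p0 T \<Longrightarrow> \<phi> \<in> T \<Longrightarrow> Syn_minus Ag p0 (Imp \<phi> \<psi>) \<Longrightarrow> \<psi> \<in> T"
  unfolding closed_theory_def by (metis CollectI subsetD)

lemma closed_theory_is_formula: "closed_theory Ag p0 T \<Longrightarrow> \<phi> \<in> T \<Longrightarrow> is_formula Ag \<phi>"
  by (auto simp: closed_theory_def)

text \<open>Reduces a propositional inference to a truth-value check, through the tautology
  \<open>Imp \<phi> (Imp \<psi> \<chi>)\<close>. Inferences from one premise use it twice.\<close>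

lemma closed_theory_prop:
  assumes T: "closed_theory Ag p0 T" and "\<phi> \<in> T" "\<psi> \<in> T" "is_formula Ag \<chi>"
    and "\<And>v. prop_eval v \<phi> \<Longrightarrow> prop_eval v \<psi> \<Longrightarrow> prop_eval v \<chi>"
  shows "\<chi> \<in> T"
proof -
  have "Imp \<phi> (Imp \<psi> \<chi>) \<in> T"
    using assms by (intro closed_theory_taut[OF T])
      (auto simp: tautology_def dest: closed_theory_is_formula)
  then show ?thesis using assms(2,3) closed_theory_MP[OF T] by blast
qed

text \<open>A deduction theorem in semantic dress: the set of consequents of \<open>\<phi>\<close>
  in \<open>T\<close> serves as the theory generated by \<open>T\<close> and
  \<open>\<phi>\<close>.\<close>

lemma closed_theory_extend:
  assumes T: "closed_theory Ag p0 T" and \<phi>: "is_formula Ag \<phi>"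
  shows "closed_theory Ag p0 {\<psi>. Imp \<phi> \<psi> \<in> T}" and "T \<subseteq> {\<psi>. Imp \<phi> \<psi> \<in> T}"
    and "Imp \<phi> \<phi> \<in> T"
proof -
  have form: "is_formula Ag \<psi>" if "Imp \<phi> \<psi> \<in> T" for \<psi>
    using closed_theory_is_formula[OF T that] by simp
  show sub: "T \<subseteq> {\<psi>. Imp \<phi> \<psi> \<in> T}"
  proof
    fix \<psi> assume "\<psi> \<in> T"
    then show "\<psi> \<in> {\<psi>. Imp \<phi> \<psi> \<in> T}"
      using \<phi> closed_theory_is_formula[OF T] closed_theory_prop[OF T, of \<psi> \<psi> "Imp \<phi> \<psi>"] by auto
  qed
  have mp: "Imp \<phi> \<chi> \<in> T" if "Imp \<phi> \<psi> \<in> T" "Imp \<phi> (Imp \<psi> \<chi>) \<in> T" for \<psi> \<chi>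
    using form[OF that(2)] \<phi> by (intro closed_theory_prop[OF T that]) auto
  have "Imp \<phi> \<psi> \<in> T" if "Syn_minus Ag p0 \<psi>" for \<psi>
    using sub T that by (auto simp: closed_theory_def)
  from form this mp show "closed_theory Ag p0 {\<psi>. Imp \<phi> \<psi> \<in> T}"
    by (rule closed_theoryI[where T = "Collect _", unfolded mem_Collect_eq])
  show "Imp \<phi> \<phi> \<in> T"
    using \<phi> by (auto intro: closed_theory_taut[OF T] simp: tautology_def)
qed

text \<open>(K) gives modus ponens under the box and necessitation supplies the theorems. This set
  is what every \<open>G\<close>-successor of \<open>T\<close> must contain.\<close>

lemma closed_theory_Box:
  assumes T: "closed_theory Ag p0 T" and G: "G \<in> agent_patterns Ag"
  shows "closed_theory Ag p0 {\<psi>. Box G \<psi> \<in> T}"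
proof -
  have form: "is_formula Ag \<psi>" if "Box G \<psi> \<in> T" for \<psi>
    using closed_theory_is_formula[OF T that] by simp
  have mp: "Box G \<chi> \<in> T" if "Box G \<psi> \<in> T" "Box G (Imp \<psi> \<chi>) \<in> T" for \<psi> \<chi>
    using form[OF that(2)] that K[OF G, of \<psi> \<chi>] closed_theory_Syn_MP[OF T] closed_theory_MP[OF T]
    by (metis is_formula_simps(1))
  have "Box G \<psi> \<in> T" if "Syn_minus Ag p0 \<psi>" for \<psi>
    using T Nec[OF G that] by (auto simp: closed_theory_def)
  from form this mp show ?thesis
    by (rule closed_theoryI[where T = "Collect _", unfolded mem_Collect_eq])
qed

text \<open>Zorn's lemma is applied to the closed extensions of \<open>T\<close> that omit
  \<open>\<chi>\<close>; omitting this fixed formula plays the part of consistency.\<close>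

lemma Lindenbaum:
  assumes T: "closed_theory Ag p0 T" and \<chi>: "\<chi> \<notin> T" "is_formula Ag \<chi>"
  obtains U where "mcs Ag p0 U" "T \<subseteq> U" "\<chi> \<notin> U"
proof -
  let ?S = "{U. closed_theory Ag p0 U \<and> T \<subseteq> U \<and> \<chi> \<notin> U}"
  have "\<exists>U \<in> ?S. \<forall>X \<in> ?S. U \<subseteq> X \<longrightarrow> X = U"
  proof (rule subset_Zorn_nonempty)
    show "?S \<noteq> {}" using T \<chi> by blast
  next
    fix C assume "C \<noteq> {}" and C: "subset.chain ?S C"
    have mp: "\<psi> \<in> \<Union>C" if "\<phi> \<in> \<Union>C" "Imp \<phi> \<psi> \<in> \<Union>C" for \<phi> \<psi>
    proof -
      from that obtain X Y where XY: "X \<in> C" "\<phi> \<in> X" "Y \<in> C" "Imp \<phi> \<psi> \<in> Y" by blast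
      then have "X \<subseteq> Y \<or> Y \<subseteq> X" using C by (auto simp: subset_chain_def)
      then obtain Z where "Z \<in> C" "\<phi> \<in> Z" "Imp \<phi> \<psi> \<in> Z" using XY by blast
      moreover from this have "closed_theory Ag p0 Z" using C by (auto simp: subset_chain_def)
      ultimately show ?thesis using closed_theory_MP[of Ag p0 Z \<phi> \<psi>] by blast
    qed
    have CS: "closed_theory Ag p0 X \<and> T \<subseteq> X \<and> \<chi> \<notin> X" if "X \<in> C" for X
      using C that by (auto simp: subset_chain_def)
    obtain X where X: "X \<in> C" using \<open>C \<noteq> {}\<close> by blast
    have "is_formula Ag \<phi>" if "\<phi> \<in> \<Union>C" for \<phi>
    proof -
      from that obtain Y where "Y \<in> C" "\<phi> \<in> Y" by blast
      then show ?thesis using CS[of Y] closed_theory_is_formula[of Ag p0 Y \<phi>] by simp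
    qed
    moreover have "\<phi> \<in> \<Union>C" if "Syn_minus Ag p0 \<phi>" for \<phi>
      using CS[OF X] X that by (auto simp: closed_theory_def)
    ultimately have "closed_theory Ag p0 (\<Union>C)"
      using mp by (rule closed_theoryI)
    then show "\<Union>C \<in> ?S" using CS X by blast
  qed
  then obtain U where "U \<in> ?S" and max: "\<forall>X \<in> ?S. U \<subseteq> X \<longrightarrow> X = U"
    by (rule bexE)
  then have U: "closed_theory Ag p0 U" "T \<subseteq> U" "\<chi> \<notin> U" by simp_all
  \<comment> \<open>Otherwise \<open>U\<close> extended by \<open>\<phi>\<close> would still omit
    \<open>\<chi>\<close>, against maximality.\<close>
  have ext: "Imp \<phi> \<chi> \<in> U" if "is_formula Ag \<phi>" "\<phi> \<notin> U" for \<phi>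
  proof (rule ccontr)
    note extend = closed_theory_extend[OF U(1) that(1)]
    assume "Imp \<phi> \<chi> \<notin> U"
    then have "{\<psi>. Imp \<phi> \<psi> \<in> U} \<in> ?S"
      using extend(1) subset_trans[OF U(2) extend(2)] by simp
    then have "{\<psi>. Imp \<phi> \<psi> \<in> U} = U" using max extend(2) by simp
    then show False using extend(3) that(2) by auto
  qed
  have "Neg \<phi> \<in> U \<longleftrightarrow> \<phi> \<notin> U" if \<phi>: "is_formula Ag \<phi>" for \<phi>
  proof
    assume "Neg \<phi> \<in> U"
    then show "\<phi> \<notin> U"
      using closed_theory_prop[OF U(1), of \<phi> "Neg \<phi>" \<chi>] \<chi> U(3) by auto
  next
    \<comment> \<open>If \<open>Neg \<phi>\<close> were missing too, both \<open>\<phi>\<close> and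
      \<open>Neg \<phi>\<close> would imply \<open>\<chi>\<close> in \<open>U\<close>, putting
      \<open>\<chi>\<close> itself into \<open>U\<close>.\<close>
    assume "\<phi> \<notin> U"
    then show "Neg \<phi> \<in> U"
      using closed_theory_prop[OF U(1), of "Imp \<phi> \<chi>" "Imp (Neg \<phi>) \<chi>" \<chi>] ext[of \<phi>]
        ext[of "Neg \<phi>"] \<chi> U(3) \<phi> by auto
  qed
  then have "mcs Ag p0 U" using U(1) by (simp add: mcs_def)
  then show thesis using U(2,3) by (rule that)
qed

section \<open>Connectives in maximal consistent theories\<close>

lemma mcs_closed_theory: "mcs Ag p0 \<Gamma> \<Longrightarrow> closed_theory Ag p0 \<Gamma>"
  by (simp add: mcs_def)

lemma mcs_Neg: "mcs Ag p0 \<Gamma> \<Longrightarrow> is_formula Ag \<phi> \<Longrightarrow> Neg \<phi> \<in> \<Gamma> \<longleftrightarrow> \<phi> \<notin> \<Gamma>"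
  by (simp add: mcs_def)

lemma mcs_Syn_MP: "mcs Ag p0 \<Gamma> \<Longrightarrow> Syn_minus Ag p0 (Imp \<phi> \<psi>) \<Longrightarrow> \<phi> \<in> \<Gamma> \<Longrightarrow> \<psi> \<in> \<Gamma>"
  by (rule closed_theory_Syn_MP[OF mcs_closed_theory])

lemma mcs_Conj:
  assumes \<Gamma>: "mcs Ag p0 \<Gamma>" and "is_formula Ag \<phi>" "is_formula Ag \<psi>"
  shows "Conj \<phi> \<psi> \<in> \<Gamma> \<longleftrightarrow> \<phi> \<in> \<Gamma> \<and> \<psi> \<in> \<Gamma>"
proof -
  note cons = closed_theory_prop[OF mcs_closed_theory[OF \<Gamma>]]
  show ?thesis
  proof (intro iffI conjI; (elim conjE)?)
    assume c: "Conj \<phi> \<psi> \<in> \<Gamma>"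
    show "\<phi> \<in> \<Gamma>" by (rule cons[OF c c assms(2)]) simp
    show "\<psi> \<in> \<Gamma>" by (rule cons[OF c c assms(3)]) simp
  next
    assume "\<phi> \<in> \<Gamma>" "\<psi> \<in> \<Gamma>"
    then show "Conj \<phi> \<psi> \<in> \<Gamma>" by (rule cons) (use assms in simp_all)
  qed
qed

lemma mcs_Disj:
  assumes "mcs Ag p0 \<Gamma>" "is_formula Ag \<phi>" "is_formula Ag \<psi>"
  shows "Disj \<phi> \<psi> \<in> \<Gamma> \<longleftrightarrow> \<phi> \<in> \<Gamma> \<or> \<psi> \<in> \<Gamma>"
  using assms by (simp add: Disj_def mcs_Neg mcs_Conj)

lemma mcs_Bot: "mcs Ag p0 \<Gamma> \<Longrightarrow> Bot p \<notin> \<Gamma>"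
  by (simp add: Bot_def mcs_Neg mcs_Conj)

lemma mcs_Disj_list:
  assumes "mcs Ag p0 \<Gamma>"
  shows "\<forall>\<phi> \<in> set \<phi>s. is_formula Ag \<phi> \<Longrightarrow> Disj_list p \<phi>s \<in> \<Gamma> \<Longrightarrow> \<exists>\<phi> \<in> set \<phi>s. \<phi> \<in> \<Gamma>"
  using assms by (induction p \<phi>s rule: Disj_list.induct) (auto simp: mcs_Bot mcs_Disj)

lemma mcs_alive:
  "mcs Ag p0 \<Gamma> \<Longrightarrow> G \<in> agent_patterns Ag \<Longrightarrow> alive p0 G \<in> \<Gamma> \<longleftrightarrow> Box G (Bot p0) \<notin> \<Gamma>"
  by (simp add: alive_def mcs_Neg)

section \<open>The canonical relations\<close>

definition can_rel :: "'a set set \<Rightarrow> ('a, 'p) fm set \<Rightarrow> ('a, 'p) fm set \<Rightarrow> bool" where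
  "can_rel G \<Gamma> \<Delta> \<longleftrightarrow> (\<forall>\<phi>. Box G \<phi> \<in> \<Gamma> \<longrightarrow> \<phi> \<in> \<Delta>)"

text \<open>The existence lemma: the unboxed formulas of \<open>\<Gamma>\<close> form a closed
  theory omitting \<open>\<psi>\<close>, which Lindenbaum extends.\<close>

lemma can_rel_witness:
  assumes \<Gamma>: "mcs Ag p0 \<Gamma>" and f: "is_formula Ag (Box G \<psi>)" and "Box G \<psi> \<notin> \<Gamma>"
  obtains \<Delta> where "mcs Ag p0 \<Delta>" "can_rel G \<Gamma> \<Delta>" "\<psi> \<notin> \<Delta>"
proof -
  have "closed_theory Ag p0 {\<psi>. Box G \<psi> \<in> \<Gamma>}"
    using \<Gamma> f by (intro closed_theory_Box) (auto intro: mcs_closed_theory)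
  then obtain \<Delta> where "mcs Ag p0 \<Delta>" "{\<psi>. Box G \<psi> \<in> \<Gamma>} \<subseteq> \<Delta>" "\<psi> \<notin> \<Delta>"
    using assms by (elim Lindenbaum) auto
  then show thesis by (intro that) (auto simp: can_rel_def)
qed

lemma can_rel_sym:
  assumes \<Gamma>: "mcs Ag p0 \<Gamma>" and \<Delta>: "mcs Ag p0 \<Delta>" and G: "G \<in> agent_patterns Ag"
    and R: "can_rel G \<Gamma> \<Delta>"
  shows "can_rel G \<Delta> \<Gamma>"
  unfolding can_rel_def
proof (intro allI impI, rule ccontr)
  fix \<phi> assume box: "Box G \<phi> \<in> \<Delta>" and "\<phi> \<notin> \<Gamma>"
  have f: "is_formula Ag \<phi>"
    using closed_theory_is_formula[OF mcs_closed_theory[OF \<Delta>] box] by simp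
  then have "Neg \<phi> \<in> \<Gamma>" using \<open>\<phi> \<notin> \<Gamma>\<close> \<Gamma> by (simp add: mcs_Neg)
  then have "Box G (Neg (Box G (Neg (Neg \<phi>)))) \<in> \<Gamma>"
    using mcs_Syn_MP[OF \<Gamma> B[OF G, of "Neg \<phi>"]] f by simp
  then have "Neg (Box G (Neg (Neg \<phi>))) \<in> \<Delta>" using R by (simp add: can_rel_def)
  \<comment> \<open>(B) for \<open>Neg \<phi>\<close> produces a double negation; propositional
    reasoning under the box matches it with \<open>\<phi>\<close>.\<close>
  moreover have "Neg (Neg \<phi>) \<in> {\<psi>. Box G \<psi> \<in> \<Delta>}"
    by (rule closed_theory_prop[OF closed_theory_Box[OF mcs_closed_theory[OF \<Delta>] G], of \<phi> \<phi>])
      (use box f in auto)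
  ultimately show False using mcs_Neg[OF \<Delta>, of "Box G (Neg (Neg \<phi>))"] f G by simp
qed

lemma can_rel_trans:
  assumes \<Gamma>: "mcs Ag p0 \<Gamma>" and G: "G \<in> agent_patterns Ag"
    and R: "can_rel G \<Gamma> \<Delta>" "can_rel G \<Delta> \<Theta>"
  shows "can_rel G \<Gamma> \<Theta>"
  unfolding can_rel_def
proof (intro allI impI)
  fix \<phi> assume box: "Box G \<phi> \<in> \<Gamma>"
  have "is_formula Ag \<phi>"
    using closed_theory_is_formula[OF mcs_closed_theory[OF \<Gamma>] box] by simp
  then have "Box G (Box G \<phi>) \<in> \<Gamma>" using mcs_Syn_MP[OF \<Gamma> Four[OF G] box] by simp
  then show "\<phi> \<in> \<Theta>" using R by (simp add: can_rel_def)
qed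

lemma can_rel_refl:
  assumes \<Gamma>: "mcs Ag p0 \<Gamma>" and G: "G \<in> agent_patterns Ag" and a: "alive p0 G \<in> \<Gamma>"
  shows "can_rel G \<Gamma> \<Gamma>"
  unfolding can_rel_def
proof (intro allI impI)
  fix \<phi> assume box: "Box G \<phi> \<in> \<Gamma>"
  have "is_formula Ag \<phi>"
    using closed_theory_is_formula[OF mcs_closed_theory[OF \<Gamma>] box] by simp
  then show "\<phi> \<in> \<Gamma>"
    using mcs_Syn_MP[OF \<Gamma> T[OF G] a] closed_theory_MP[OF mcs_closed_theory[OF \<Gamma>] box] by blast
qed

text \<open>A boxed \<open>Bot\<close> at one end would put \<open>Bot\<close> into the theory at
  the other end.\<close>

lemma can_rel_alive:
  assumes "mcs Ag p0 \<Gamma>" "mcs Ag p0 \<Delta>" "G \<in> agent_patterns Ag" "can_rel G \<Gamma> \<Delta>"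
  shows "alive p0 G \<in> \<Gamma>" "alive p0 G \<in> \<Delta>"
proof -
  have "Bot p0 \<notin> \<Gamma>" "Bot p0 \<notin> \<Delta>" using assms(1,2) mcs_Bot by metis+
  then have "Box G (Bot p0) \<notin> \<Gamma>" "Box G (Bot p0) \<notin> \<Delta>"
    using assms(4) can_rel_sym[OF assms] unfolding can_rel_def by metis+
  then show "alive p0 G \<in> \<Gamma>" "alive p0 G \<in> \<Delta>"
    using mcs_alive[OF assms(1,3)] mcs_alive[OF assms(2,3)] by simp_all
qed

lemma can_rel_mono:
  assumes \<Gamma>: "mcs Ag p0 \<Gamma>" and "G \<in> agent_patterns Ag" "H \<in> agent_patterns Ag" "G \<subseteq> H"
    and R: "can_rel H \<Gamma> \<Delta>"
  shows "can_rel G \<Gamma> \<Delta>"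
  unfolding can_rel_def
proof (intro allI impI)
  fix \<phi> assume box: "Box G \<phi> \<in> \<Gamma>"
  have "is_formula Ag \<phi>"
    using closed_theory_is_formula[OF mcs_closed_theory[OF \<Gamma>] box] by simp
  then have "Box H \<phi> \<in> \<Gamma>" using mcs_Syn_MP[OF \<Gamma> Mono[OF assms(2-4)] box] by simp
  then show "\<phi> \<in> \<Delta>" using R by (simp add: can_rel_def)
qed

text \<open>(Equiv) adds the members of \<open>G\<close> to \<open>H\<close> one at a time without
  losing the relation; (Mono) then discards \<open>H\<close>.\<close>

lemma can_rel_refine:
  assumes \<Gamma>: "mcs Ag p0 \<Gamma>" and H: "H \<in> agent_patterns Ag"
    and "finite G" "G \<in> agent_patterns Ag" "\<forall>B \<in> G. \<exists>A \<in> H. B \<subseteq> A" and R: "can_rel H \<Gamma> \<Delta>"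
  shows "can_rel G \<Gamma> \<Delta>"
proof -
  have "can_rel (H \<union> G) \<Gamma> \<Delta>"
    using assms(3-5)
  proof (induction G rule: finite_induct)
    case empty
    then show ?case using R by simp
  next
    case (insert B G)
    then obtain A where A: "A \<in> H \<union> G" "B \<subseteq> A" by blast
    have HG: "H \<union> G \<in> agent_patterns Ag" "B \<noteq> {}" using insert H by auto
    show ?case
      unfolding can_rel_def
    proof (intro allI impI)
      fix \<phi> assume box: "Box (H \<union> insert B G) \<phi> \<in> \<Gamma>"
      have f: "is_formula Ag \<phi>"
        using closed_theory_is_formula[OF mcs_closed_theory[OF \<Gamma>] box] by simp
      have "Box (H \<union> G) \<phi> \<in> \<Gamma>"
        using mcs_Syn_MP[OF \<Gamma> Equiv[OF HG(1) A HG(2) f]] box by simp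
      then show "\<phi> \<in> \<Delta>" using insert by (simp add: can_rel_def)
    qed
  qed
  then show ?thesis
    using can_rel_mono[OF \<Gamma> assms(4), of "H \<union> G"] assms(4) H by auto
qed

text \<open>Aliveness amounts to being \<open>can_rel\<close>-related to itself, so it is
  transferred as a relation.\<close>

lemma alive_refine:
  assumes "mcs Ag p0 \<Gamma>" "H \<in> agent_patterns Ag"
    and "finite G" "G \<in> agent_patterns Ag" "\<forall>B \<in> G. \<exists>A \<in> H. B \<subseteq> A" and "alive p0 H \<in> \<Gamma>"
  shows "alive p0 G \<in> \<Gamma>"
proof -
  have "can_rel G \<Gamma> \<Gamma>"
    using can_rel_refine[OF assms(1-5) can_rel_refl[OF assms(1,2,6)]] .
  then show ?thesis by (rule can_rel_alive(1)[OF assms(1,1,4)])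
qed

text \<open>(NE) makes some pattern alive, and the empty pattern refines it vacuously.\<close>

lemma alive_empty:
  assumes "finite Ag" and \<Gamma>: "mcs Ag p0 \<Gamma>"
  shows "alive p0 {} \<in> \<Gamma>"
proof -
  obtain Gs where Gs: "set Gs = agent_patterns Ag" "distinct Gs"
    using finite_distinct_list finite_agent_patterns[OF assms(1)] by blast
  then have "Disj_list p0 (map (alive p0) Gs) \<in> \<Gamma>"
    using NE[OF Gs(2,1), of p0] mcs_closed_theory[OF \<Gamma>] by (auto simp: closed_theory_def)
  then obtain G where "G \<in> agent_patterns Ag" "alive p0 G \<in> \<Gamma>"
    using mcs_Disj_list[OF \<Gamma>, of "map (alive p0) Gs"] Gs by auto
  then show ?thesis using alive_refine[OF \<Gamma>, of G "{}"] by simp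
qed

text \<open>Repeated use of (Union) shows that singletons decide aliveness, as (D) forces in the
  model.\<close>

lemma alive_Union:
  assumes "finite Ag" and \<Gamma>: "mcs Ag p0 \<Gamma>"
    and "finite G" "G \<in> agent_patterns Ag" "\<forall>B \<in> G. alive p0 {B} \<in> \<Gamma>"
  shows "alive p0 G \<in> \<Gamma>"
  using assms(3-5)
proof (induction G rule: finite_induct)
  case empty
  show ?case using alive_empty[OF assms(1) \<Gamma>] .
next
  case (insert B G)
  then have "Conj (alive p0 {B}) (alive p0 G) \<in> \<Gamma>"
    using \<Gamma> by (simp add: mcs_Conj)
  then show ?case
    using mcs_Syn_MP[OF \<Gamma> Union, of "{B}" G] insert by simp
qed

section \<open>The unravelled model\<close>

text \<open>A node is the list of boxes refuted on the way from the root to it, the most recent one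
  first.\<close>

type_synonym ('a, 'p) path = "('a set set \<times> ('a, 'p) fm) list"

text \<open>The choice depends on the path alone, so each node carries one theory. It is meaningful
  on valid paths, where \<open>can_rel_witness\<close> provides a candidate.\<close>

fun end_theory :: "'a set \<Rightarrow> 'p \<Rightarrow> ('a, 'p) fm set \<Rightarrow> ('a, 'p) path \<Rightarrow> ('a, 'p) fm set" where
  "end_theory Ag p0 \<Gamma> [] = \<Gamma>"
| "end_theory Ag p0 \<Gamma> ((H, \<psi>) # l) =
    (SOME \<Delta>. mcs Ag p0 \<Delta> \<and> can_rel H (end_theory Ag p0 \<Gamma> l) \<Delta> \<and> \<psi> \<notin> \<Delta>)"

text \<open>A node gets a child for exactly those boxes from \<open>E\<close> that its theory
  refutes.\<close>

fun valid_path ::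
  "'a set \<Rightarrow> 'p \<Rightarrow> ('a, 'p) fm set \<Rightarrow> ('a set set \<times> ('a, 'p) fm) set \<Rightarrow> ('a, 'p) path \<Rightarrow> bool" where
  "valid_path Ag p0 \<Gamma> E [] \<longleftrightarrow> True"
| "valid_path Ag p0 \<Gamma> E ((H, \<psi>) # l) \<longleftrightarrow>
    valid_path Ag p0 \<Gamma> E l \<and> (H, \<psi>) \<in> E \<and> Box H \<psi> \<notin> end_theory Ag p0 \<Gamma> l"

text \<open>The latest edge comes first, so dropping from the front moves towards the root. An edge
  is passed only if its label covers all members of \<open>G\<close>.\<close>

definition climb :: "'a set set \<Rightarrow> ('a, 'p) path \<Rightarrow> ('a, 'p) path" where
  "climb G = dropWhile (\<lambda>(H, \<psi>). \<forall>B \<in> G. \<exists>A \<in> H. B \<subseteq> A)"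

lemma climb_simps [simp]:
  "climb G [] = []"
  "climb G ((H, \<psi>) # l) = (if \<forall>B \<in> G. \<exists>A \<in> H. B \<subseteq> A then climb G l else (H, \<psi>) # l)"
  by (auto simp: climb_def)

lemma climb_empty [simp]: "climb {} l = []"
  by (induction l) auto

text \<open>The climb for \<open>G\<close> stops at an edge failing some \<open>B\<close> in
  \<open>G\<close>, and the climb for this \<open>B\<close> cannot stop earlier. If the root is
  reached, any \<open>B\<close> will do.\<close>

lemma climb_singleton_witness: "G \<noteq> {} \<Longrightarrow> \<exists>B \<in> G. climb G l = climb {B} l"
proof (induction l)
  case (Cons e l)
  obtain H \<psi> where e: "e = (H, \<psi>)" by (cases e)
  show ?case
  proof (cases "\<forall>B \<in> G. \<exists>A \<in> H. B \<subseteq> A")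
    case True
    then show ?thesis using Cons e by auto
  next
    case False
    then obtain B where "B \<in> G" "\<not> (\<exists>A \<in> H. B \<subseteq> A)" by blast
    then show ?thesis using False e by (intro bexI[of _ B]) auto
  qed
qed auto

text \<open>An edge that counts for all of \<open>G\<close> counts for \<open>B\<close>, so the
  climb for \<open>B\<close> goes at least as far.\<close>

lemma climb_suffix: "B \<in> G \<Longrightarrow> \<exists>k. climb G l = k @ climb {B} l"
proof (induction l)
  case (Cons e l)
  then obtain k where k: "climb G l = k @ climb {B} l" by blast
  obtain H \<psi> where e: "e = (H, \<psi>)" by (cases e)
  show ?case
  proof (cases "\<forall>B \<in> G. \<exists>A \<in> H. B \<subseteq> A")
    case True
    then show ?thesis using k Cons.prems e by auto
  next
    case False
    have "\<exists>k. e # l = k @ climb {B} (e # l)"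
      unfolding climb_def by (rule exI, rule takeWhile_dropWhile_id[symmetric])
    moreover have "climb G (e # l) = e # l" unfolding e climb_simps using False by (rule if_not_P)
    ultimately show ?thesis by simp
  qed
qed simp

text \<open>By the two preceding facts, each of the two \<open>G\<close>-climbs is a suffix of the
  other, hence they coincide. This is where agreement for single members becomes agreement for the
  pattern.\<close>

lemma climb_eqI:
  assumes "G \<noteq> {}" and eq: "\<forall>B \<in> G. climb {B} l = climb {B} l'"
  shows "climb G l = climb G l'"
proof -
  obtain B where B: "B \<in> G" "climb G l = climb {B} l'"
    using climb_singleton_witness[OF assms(1)] eq by metis
  obtain B' where B': "B' \<in> G" "climb G l' = climb {B'} l"
    using climb_singleton_witness[OF assms(1)] eq by metis
  obtain k where k: "climb G l' = k @ climb G l"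
    using climb_suffix[OF B(1)] B(2) by metis
  obtain k' where k': "climb G l = k' @ climb G l'"
    using climb_suffix[OF B'(1)] B'(2) by metis
  have "length k = 0" using arg_cong[OF k, of length] arg_cong[OF k', of length] by simp
  then show ?thesis using k by simp
qed

text \<open>Worlds are named by a map \<open>g\<close> onto the nodes, which need not be injective.\<close>

definition tree_model ::
  "'a set \<Rightarrow> 'p \<Rightarrow> ('a, 'p) fm set \<Rightarrow> ('w \<Rightarrow> ('a, 'p) path) \<Rightarrow> ('w, 'a, 'p) model" where
  "tree_model Ag p0 \<Gamma> g = \<lparr>worlds = UNIV,
    rel = (\<lambda>G. {(x, y). \<forall>B \<in> G. climb {B} (g x) = climb {B} (g y) \<and>
      alive p0 {B} \<in> end_theory Ag p0 \<Gamma> (g x) \<and> alive p0 {B} \<in> end_theory Ag p0 \<Gamma> (g y)}),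
    val = (\<lambda>x. {p. Atom p \<in> end_theory Ag p0 \<Gamma> (g x)})\<rparr>"

text \<open>These pairs will be the edge labels of the tree.\<close>

primrec boxes :: "('a, 'p) fm \<Rightarrow> ('a set set \<times> ('a, 'p) fm) set" where
  "boxes (Atom p) = {}"
| "boxes (Neg \<phi>) = boxes \<phi>"
| "boxes (Conj \<phi> \<psi>) = boxes \<phi> \<union> boxes \<psi>"
| "boxes (Box G \<phi>) = insert (G, \<phi>) (boxes \<phi>)"

lemma finite_boxes: "finite (boxes \<phi>)"
  by (induction \<phi>) auto

lemma boxes_is_formula: "is_formula Ag \<phi> \<Longrightarrow> (G, \<psi>) \<in> boxes \<phi> \<Longrightarrow> is_formula Ag (Box G \<psi>)"
  by (induction \<phi>) auto

section \<open>Truth and frame conditions in the tree\<close>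

locale unravelling =
  fixes Ag :: "'a set" and p0 :: 'p and \<Gamma> :: "('a, 'p) fm set"
    and E :: "('a set set \<times> ('a, 'p) fm) set" and g :: "'w \<Rightarrow> ('a, 'p) path"
  assumes fin: "finite Ag" and root: "mcs Ag p0 \<Gamma>"
    and E: "(H, \<psi>) \<in> E \<Longrightarrow> is_formula Ag (Box H \<psi>)"
    and range: "range g = {l. valid_path Ag p0 \<Gamma> E l}"
begin

abbreviation "th \<equiv> end_theory Ag p0 \<Gamma>"
abbreviation "valid \<equiv> valid_path Ag p0 \<Gamma> E"
abbreviation "M \<equiv> tree_model Ag p0 \<Gamma> g"

lemma end_theory_step:
  assumes "mcs Ag p0 (th l)" "valid ((H, \<psi>) # l)"
  shows "mcs Ag p0 (th ((H, \<psi>) # l)) \<and> can_rel H (th l) (th ((H, \<psi>) # l)) \<and>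
    \<psi> \<notin> th ((H, \<psi>) # l)"
proof -
  obtain \<Delta> where "mcs Ag p0 \<Delta> \<and> can_rel H (th l) \<Delta> \<and> \<psi> \<notin> \<Delta>"
    using can_rel_witness[OF assms(1) E, of H \<psi>] assms(2) by auto
  then show ?thesis unfolding end_theory.simps by (rule someI)
qed

lemma mcs_end_theory: "valid l \<Longrightarrow> mcs Ag p0 (th l)"
proof (induction l)
  case Nil
  then show ?case using root by simp
next
  case (Cons e l)
  then show ?case using end_theory_step[of l "fst e" "snd e"] by (cases e) auto
qed

lemma end_theory_Cons:
  assumes "valid ((H, \<psi>) # l)"
  shows "mcs Ag p0 (th l)" "mcs Ag p0 (th ((H, \<psi>) # l))" "H \<in> agent_patterns Ag"
    "can_rel H (th l) (th ((H, \<psi>) # l))" "\<psi> \<notin> th ((H, \<psi>) # l)"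
  using assms mcs_end_theory[of l] end_theory_step[of l H \<psi>] E[of H \<psi>] by auto

lemma valid_g: "valid (g x)"
  using range by auto

lemma valid_climb: "valid l \<Longrightarrow> valid (climb G l)"
  by (induction l) (auto split: prod.splits)

text \<open>Each edge passed is a \<open>G\<close>-step by refinement of its label; symmetry directs
  it to the root and transitivity composes. Aliveness handles the path of length zero.\<close>

lemma can_rel_climb:
  assumes G: "G \<in> agent_patterns Ag"
  shows "valid l \<Longrightarrow> alive p0 G \<in> th l \<Longrightarrow> can_rel G (th l) (th (climb G l))"
proof (induction l)
  case Nil
  then show ?case using can_rel_refl[OF root G] by simp
next
  case (Cons e l)
  obtain H \<psi> where e: "e = (H, \<psi>)" by (cases e)
  note step = end_theory_Cons[OF Cons.prems(1)[unfolded e]]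
  show ?case
  proof (cases "\<forall>B \<in> G. \<exists>A \<in> H. B \<subseteq> A")
    case True
    then have R: "can_rel G (th l) (th (e # l))"
      using can_rel_refine[OF step(1,3) finite_agent_pattern[OF fin G] G _ step(4)] e by simp
    \<comment> \<open>Aliveness of \<open>G\<close> moves to the parent along the edge, so the
      induction hypothesis applies.\<close>
    then have "can_rel G (th l) (th (climb G l))"
      using Cons can_rel_alive(1)[OF step(1,2) G] e by simp
    then have "can_rel G (th (e # l)) (th (climb G l))"
      using can_rel_trans[OF step(2) G can_rel_sym[OF step(1,2) G]] R e by simp
    then show ?thesis using True e by simp
  next
    case False
    then show ?thesis using can_rel_refl[OF step(2) G] Cons.prems e by auto
  qed
qed

lemma can_rel_tree:
  assumes G: "G \<in> agent_patterns Ag" and R: "(x, y) \<in> rel M G"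
  shows "can_rel G (th (g x)) (th (g y))"
proof -
  note fG = finite_agent_pattern[OF fin G]
  note mx = mcs_end_theory[OF valid_g[of x]] and my = mcs_end_theory[OF valid_g[of y]]
  have "alive p0 G \<in> th (g x)" "alive p0 G \<in> th (g y)"
    using R alive_Union[OF fin mx fG G] alive_Union[OF fin my fG G] by (auto simp: tree_model_def)
  \<comment> \<open>For the empty pattern both climbs end at the root.\<close>
  moreover have "climb G (g x) = climb G (g y)"
    using R climb_eqI[of G "g x" "g y"] by (cases "G = {}") (auto simp: tree_model_def)
  ultimately have "can_rel G (th (g x)) (th (climb G (g x)))"
      "can_rel G (th (g y)) (th (climb G (g x)))"
    using can_rel_climb[OF G valid_g, of x] can_rel_climb[OF G valid_g, of y] by simp_all
  then show ?thesis
    using can_rel_trans[OF mx G] can_rel_sym[OF my mcs_end_theory[OF valid_climb[OF valid_g]] G]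
    by metis
qed

lemma truth:
  "is_formula Ag \<phi> \<Longrightarrow> boxes \<phi> \<subseteq> E \<Longrightarrow> sat M x \<phi> \<longleftrightarrow> \<phi> \<in> th (g x)"
proof (induction \<phi> arbitrary: x)
  case (Atom p)
  then show ?case by (simp add: tree_model_def)
next
  case (Neg \<phi>)
  then show ?case using mcs_Neg[OF mcs_end_theory[OF valid_g]] by simp
next
  case (Conj \<phi> \<psi>)
  then show ?case using mcs_Conj[OF mcs_end_theory[OF valid_g]] by simp
next
  case (Box G \<phi>)
  then have G: "G \<in> agent_patterns Ag" by simp
  show ?case
  proof
    assume "Box G \<phi> \<in> th (g x)"
    then have "\<phi> \<in> th (g y)" if "(x, y) \<in> rel M G" for y
      using can_rel_tree[OF G that] by (simp add: can_rel_def)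
    then show "sat M x (Box G \<phi>)" using Box by simp
  next
    assume sat: "sat M x (Box G \<phi>)"
    show "Box G \<phi> \<in> th (g x)"
    proof (rule ccontr)
      assume "Box G \<phi> \<notin> th (g x)"
      \<comment> \<open>The refuted box is itself a legal edge, so the child along it is a node
        whose theory omits \<open>\<phi>\<close>.\<close>
      then have v: "valid ((G, \<phi>) # g x)" using Box valid_g by simp
      then obtain y where y: "g y = (G, \<phi>) # g x" using range by (metis mem_Collect_eq rangeE)
      note step = end_theory_Cons[OF v]
      have "alive p0 {B} \<in> th (g x) \<and> alive p0 {B} \<in> th (g y)" if "B \<in> G" for B
      proof -
        have "{B} \<in> agent_patterns Ag" using agent_patternsD[OF G that] by simp
        then show ?thesis
          using that y can_rel_alive[OF step(1,2) G step(4)]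
            alive_refine[OF step(1) G, of "{B}"] alive_refine[OF step(2) G, of "{B}"] by auto
      qed
      \<comment> \<open>The label \<open>G\<close> covers each of its own members, so climbing from
        the child passes through its parent.\<close>
      then have "(x, y) \<in> rel M G" using y by (auto simp: tree_model_def)
      then have "\<phi> \<in> th (g y)" using sat Box by simp
      then show False using step(5) y by simp
    qed
  qed
qed

lemma delta_model_tree: "delta_model Ag M"
proof -
  have pre: "pre_model Ag M"
    unfolding pre_model_def tree_model_def by (auto intro!: symI transI)
  have clo: "alive_set M G \<subseteq> alive_set M {A \<union> B}"
    if G: "G \<in> agent_patterns Ag" and "A \<in> G" "B \<in> G" for G A B
  proof
    fix x assume "x \<in> alive_set M G"
    then have "alive p0 G \<in> th (g x)"
      using alive_Union[OF fin mcs_end_theory[OF valid_g] finite_agent_pattern[OF fin G] G]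
      by (auto simp: alive_set_def tree_model_def)
    then have "alive p0 {A \<union> B} \<in> th (g x)"
      using mcs_Syn_MP[OF mcs_end_theory[OF valid_g] Clo[OF that]] by blast
    then show "x \<in> alive_set M {A \<union> B}" by (simp add: alive_set_def tree_model_def)
  qed
  have down: "rel M {A} \<subseteq> rel M {B}"
    if A: "{A} \<in> agent_patterns Ag" and B: "B \<noteq> {}" "B \<subseteq> A" for A B
  proof -
    have pB: "{B} \<in> agent_patterns Ag" using A B by auto
    have alive: "alive p0 {B} \<in> th (g x)" if "alive p0 {A} \<in> th (g x)" for x
      using alive_refine[OF mcs_end_theory[OF valid_g] A, of "{B}"] pB B that by auto
    \<comment> \<open>A label covering \<open>A\<close> covers its subset \<open>B\<close>, so the
      climb for \<open>B\<close> passes the node where that for \<open>A\<close> stops.\<close>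
    have "climb {B} l = climb {B} (climb {A} l)" for l :: "('a, 'p) path"
    proof (induction l)
      case (Cons e l)
      obtain H \<psi> where e: "e = (H, \<psi>)" by (cases e)
      have "\<exists>C \<in> H. B \<subseteq> C" if "\<exists>C \<in> H. A \<subseteq> C" using B that by blast
      then show ?case using Cons e by (cases "\<exists>C \<in> H. A \<subseteq> C") auto
    qed simp
    then have climb: "climb {B} l = climb {B} l'" if "climb {A} l = climb {A} l'"
      for l l' :: "('a, 'p) path" using that by metis
    show ?thesis
      unfolding tree_model_def
      by (auto intro: alive climb)
  qed
  \<comment> \<open>Built into \<open>tree_model\<close>; as every element of the type is a world,
    this is (D).\<close>
  have D: "rel M G = (\<Inter>B \<in> G. rel M {B})" for G
    by (auto simp: tree_model_def)
  have equiv: "rel M G \<subseteq> rel M (G \<union> {B})"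
    if "G \<in> agent_patterns Ag" "A \<in> G" "B \<noteq> {}" "B \<subseteq> A" for G A B
  proof -
    have "rel M {A} \<subseteq> rel M {B}"
      using that agent_patternsD[OF that(1,2)] by (intro down) auto
    then show ?thesis using D[of G] D[of "G \<union> {B}"] that(2) by auto
  qed
  have w: "worlds M = UNIV" by (simp add: tree_model_def)
  have mono: "rel M H \<subseteq> rel M G" if "G \<subseteq> H" for G H
    using D[of G] D[of H] that by auto
  have "(x, x) \<in> rel M {}" for x by (simp add: tree_model_def)
  then have ne: "\<exists>G \<in> agent_patterns Ag. (x, x) \<in> rel M G" for x by (metis agent_patterns_empty)
  show ?thesis
    unfolding delta_model_def
  proof (intro conjI ballI allI impI; (elim conjE)?)
    show "rel M G = (worlds M \<times> worlds M) \<inter> (\<Inter>B \<in> G. rel M {B})" for G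
      using D[of G] unfolding w UNIV_Times_UNIV Int_UNIV_left .
  qed (rule pre clo mono equiv ne; assumption)+
qed

end

section \<open>Naming the nodes and completeness\<close>

lemma surj_from_infinite:
  assumes "infinite (UNIV :: 'w set)" "countable W" "W \<noteq> {}"
  obtains g :: "'w \<Rightarrow> 'b" where "range g = W"
proof -
  \<comment> \<open>The inverse of an injection of the naturals is onto the naturals; an enumeration
    of \<open>W\<close> follows it.\<close>
  obtain f :: "nat \<Rightarrow> 'w" where f: "inj f"
    using infinite_countable_subset[OF assms(1)] by blast
  have "range (from_nat_into W \<circ> inv f) = from_nat_into W ` range (inv f)"
    by (rule image_comp[symmetric])
  also have "\<dots> = W"
    using assms range_from_nat_into inj_imp_surj_inv[OF f] by metis
  finally show thesis by (rule that)
qed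

lemma countable_valid_path:
  assumes "countable E"
  shows "countable {l. valid_path Ag p0 \<Gamma> E l}"
proof (rule countable_subset)
  have "valid_path Ag p0 \<Gamma> E l \<Longrightarrow> l \<in> lists E" for l
    by (induction l) auto
  then show "{l. valid_path Ag p0 \<Gamma> E l} \<subseteq> lists E" by blast
  show "countable (lists E)" using assms by (rule countable_lists)
qed

theorem theorem5p37:
  fixes Ag :: "'a set" and p0 :: "'p::countable" and \<phi> :: "('a, 'p) fm"
  assumes "finite Ag"
    and "infinite (UNIV :: 'w set)"
    and "is_formula Ag \<phi>"
  shows "Syn_minus Ag p0 \<phi> \<longleftrightarrow>
    (\<forall>M :: ('w, 'a, 'p) model. delta_model Ag M \<longrightarrow> (\<forall>w \<in> worlds M. sat M w \<phi>))"
proof (intro iffI allI impI ballI)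
  fix M :: "('w, 'a, 'p) model" and w
  assume "Syn_minus Ag p0 \<phi>" "delta_model Ag M" "w \<in> worlds M"
  then show "sat M w \<phi>" by (intro Syn_minus_sound)
next
  assume valid: "\<forall>M :: ('w, 'a, 'p) model. delta_model Ag M \<longrightarrow> (\<forall>w \<in> worlds M. sat M w \<phi>)"
  show "Syn_minus Ag p0 \<phi>"
  proof (rule ccontr)
    assume "\<not> Syn_minus Ag p0 \<phi>"
    \<comment> \<open>The theory to be extended is the set of theorems, which omits
      \<open>\<phi>\<close>; the result becomes the root.\<close>
    then obtain \<Gamma> where \<Gamma>: "mcs Ag p0 \<Gamma>" "\<phi> \<notin> \<Gamma>"
      using Lindenbaum[OF closed_theory_Syn_minus, of \<phi> Ag p0] assms(3) by auto
    let ?W = "{l. valid_path Ag p0 \<Gamma> (boxes \<phi>) l}"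
    have "[] \<in> ?W" by simp
    then have "?W \<noteq> {}" by blast
    then obtain g :: "'w \<Rightarrow> ('a, 'p) path" where g: "range g = ?W"
      using surj_from_infinite[OF assms(2) countable_valid_path]
        countable_finite[OF finite_boxes] by metis
    interpret unravelling Ag p0 \<Gamma> "boxes \<phi>" g
      by (rule unravelling.intro[OF assms(1) \<Gamma>(1) boxes_is_formula[OF assms(3)] g])
    \<comment> \<open>The empty path carries the root theory, so any world naming it refutes
      \<open>\<phi>\<close>.\<close>
    have "[] \<in> range g" unfolding g by simp
    then obtain x where x: "[] = g x" by (rule rangeE)
    have "x \<in> worlds M" by (simp add: tree_model_def)
    then have "sat M x \<phi>" using valid[rule_format, OF delta_model_tree] by simp
    then show False using truth[OF assms(3), of x] x[symmetric] \<Gamma>(2) by simp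
  qed
qed

end
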